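(* Let $\mathcal{C}=(C,d)$ be a finite chain complex of free abelian groups and let $((C,d),H,f,g,\phi,\lambda)$ be a $\lambda$-AT-model for $\mathcal{C}$, where $\lambda$ is a non-zero integer. If $p$ is a prime and $p^{t}$ (with $t\ge 1$) is an invariant factor of $H_q(\mathcal{C};\mathbf{Z})$ for some $q$, then $p$ divides $\lambda$.
   Context: A finite chain complex $\mathcal{C}$ is a sequence of finitely generated free abelian groups $\mathcal{C}_q$ (zero for $q<0$ and for $q>n$) with differential $d_q:\mathcal{C}_q\to\mathcal{C}_{q-1}$, $d_qd_{q+1}=0$; it is encoded as $(C,d)$ with $C=\{C_q\}$, $C_q$ a finite basis of $\mathcal{C}_q$. The torsion subgroup of $H_q(\mathcal{C};\mathbf{Z})$ is a direct sum of cyclic groups $\mathbf{Z}/\alpha_{(q,i)}$ with each $\alpha_{(q,i)}>1$ a power of a prime; the uniquely determined numbers $\alpha_{(q,i)}$ are called the invariant factors of $H_q(\mathcal{C};\mathbf{Z})$. A $\lambda$-chain contraction ($\lambda\in\mathbf{Z}$, $\lambda\ne0$) of $(\mathcal{C},d)$ to $(\mathcal{C}',d')$ is a set $(f,g,\phi,\lambda)$ with $f:\mathcal{C}\to\mathcal{C}'$ and $g:\mathcal{C}'\to\mathcal{C}$ chain maps and $\phi=\{\phi_q:\mathcal{C}_q\to\mathcal{C}_{q+1}\}$ homomorphisms such that $fg=\lambda\, id_{\mathcal{C}'}$ and $\lambda\, id_{\mathcal{C}}-gf=\phi d+d\phi$. A $\lambda$-AT-model for $\mathcal{C}=(C,d)$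 is a set $((C,d),H,f,g,\phi,\lambda)$ where $H=\{H_q\}$ is a graded set freely generating a chain complex $\mathcal{H}$ with zero differential, and $(f,g,\phi,\lambda)$ is a $\lambda$-chain contraction of $\mathcal{C}$ to $\mathcal{H}$. *)

theory Defs
  imports
    "HOL-Algebra.Free_Abelian_Groups"
    "HOL-Algebra.Elementary_Groups"
    "HOL-Number_Theory.Prime_Powers"
begin

text \<open>
  A chain complex is encoded by its graded basis \<open>C\<close> and its differential \<open>d\<close>: the group of
  \<open>q\<close>-chains is the free abelian group on \<open>C q\<close>, and \<open>d q\<close> maps \<open>q\<close>-chains to \<open>(q-1)\<close>-chains.
  Degrees are integers. All graded maps are only meaningful on the carriers.
\<close>

definition chains :: "(int \<Rightarrow> 'a set) \<Rightarrow> int \<Rightarrow> ('a \<Rightarrow>\<^sub>0 int) monoid" where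
  "chains C q = free_Abelian_group (C q)"

definition chain_complex ::
    "(int \<Rightarrow> 'a set) \<Rightarrow> (int \<Rightarrow> ('a \<Rightarrow>\<^sub>0 int) \<Rightarrow> ('a \<Rightarrow>\<^sub>0 int)) \<Rightarrow> bool" where
  "chain_complex C d \<longleftrightarrow>
     (\<forall>q. d q \<in> hom (chains C q) (chains C (q - 1))) \<and>
     (\<forall>q. \<forall>x \<in> carrier (chains C (q + 1)). d q (d (q + 1) x) = 0)"

definition finite_chain_complex ::
    "(int \<Rightarrow> 'a set) \<Rightarrow> (int \<Rightarrow> ('a \<Rightarrow>\<^sub>0 int) \<Rightarrow> ('a \<Rightarrow>\<^sub>0 int)) \<Rightarrow> bool" where
  "finite_chain_complex C d \<longleftrightarrow>
     chain_complex C d \<and> (\<forall>q. finite (C q)) \<and>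
     (\<exists>n::nat. \<forall>q. q < 0 \<or> q > int n \<longrightarrow> C q = {})"

definition homology ::
    "(int \<Rightarrow> 'a set) \<Rightarrow> (int \<Rightarrow> ('a \<Rightarrow>\<^sub>0 int) \<Rightarrow> ('a \<Rightarrow>\<^sub>0 int)) \<Rightarrow> int \<Rightarrow> ('a \<Rightarrow>\<^sub>0 int) set monoid" where
  "homology C d q =
     (chains C q)\<lparr>carrier := kernel (chains C q) (chains C (q - 1)) (d q)\<rparr>
       Mod (d (q + 1) ` carrier (chains C (q + 1)))"

definition torsion_subgroup :: "'a monoid \<Rightarrow> 'a monoid" where
  "torsion_subgroup G =
     G\<lparr>carrier := {x \<in> carrier G. \<exists>n::nat. n > 0 \<and> x [^]\<^bsub>G\<^esub> n = \<one>\<^bsub>G\<^esub>}\<rparr>"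

text \<open>
  The list of invariant factors, taken in the primary decomposition of the torsion subgroup: every
  entry is a prime power greater than \<open>1\<close>. It is determined by \<open>G\<close> up to permutation.
\<close>

definition invariant_factors :: "'a monoid \<Rightarrow> nat list \<Rightarrow> bool" where
  "invariant_factors G as \<longleftrightarrow>
     (\<forall>a \<in> set as. primepow a) \<and>
     torsion_subgroup G \<cong> sum_group {..<length as} (\<lambda>i. integer_mod_group (as ! i))"

definition invariant_factor :: "'a monoid \<Rightarrow> nat \<Rightarrow> bool" where
  "invariant_factor G a \<longleftrightarrow> (\<exists>as. invariant_factors G as \<and> a \<in> set as)"

definition chain_map ::
    "(int \<Rightarrow> 'a set) \<Rightarrow> (int \<Rightarrow> ('a \<Rightarrow>\<^sub>0 int) \<Rightarrow> ('a \<Rightarrow>\<^sub>0 int)) \<Rightarrow>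
     (int \<Rightarrow> 'b set) \<Rightarrow> (int \<Rightarrow> ('b \<Rightarrow>\<^sub>0 int) \<Rightarrow> ('b \<Rightarrow>\<^sub>0 int)) \<Rightarrow>
     (int \<Rightarrow> ('a \<Rightarrow>\<^sub>0 int) \<Rightarrow> ('b \<Rightarrow>\<^sub>0 int)) \<Rightarrow> bool" where
  "chain_map C d C' d' f \<longleftrightarrow>
     (\<forall>q. f q \<in> hom (chains C q) (chains C' q)) \<and>
     (\<forall>q. \<forall>x \<in> carrier (chains C q). d' q (f q x) = f (q - 1) (d q x))"

definition chain_contraction ::
    "(int \<Rightarrow> 'a set) \<Rightarrow> (int \<Rightarrow> ('a \<Rightarrow>\<^sub>0 int) \<Rightarrow> ('a \<Rightarrow>\<^sub>0 int)) \<Rightarrow>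
     (int \<Rightarrow> 'b set) \<Rightarrow> (int \<Rightarrow> ('b \<Rightarrow>\<^sub>0 int) \<Rightarrow> ('b \<Rightarrow>\<^sub>0 int)) \<Rightarrow>
     (int \<Rightarrow> ('a \<Rightarrow>\<^sub>0 int) \<Rightarrow> ('b \<Rightarrow>\<^sub>0 int)) \<Rightarrow>
     (int \<Rightarrow> ('b \<Rightarrow>\<^sub>0 int) \<Rightarrow> ('a \<Rightarrow>\<^sub>0 int)) \<Rightarrow>
     (int \<Rightarrow> ('a \<Rightarrow>\<^sub>0 int) \<Rightarrow> ('a \<Rightarrow>\<^sub>0 int)) \<Rightarrow> int \<Rightarrow> bool" where
  "chain_contraction C d C' d' f g \<phi> l \<longleftrightarrow>
     l \<noteq> 0 \<and>
     chain_complex C d \<and> chain_complex C' d' \<and>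
     chain_map C d C' d' f \<and> chain_map C' d' C d g \<and>
     (\<forall>q. \<phi> q \<in> hom (chains C q) (chains C (q + 1))) \<and>
     (\<forall>q. \<forall>y \<in> carrier (chains C' q). f q (g q y) = frag_cmul l y) \<and>
     (\<forall>q. \<forall>x \<in> carrier (chains C q).
        frag_cmul l x - g q (f q x) = \<phi> (q - 1) (d q x) + d (q + 1) (\<phi> q x))"

definition AT_model ::
    "(int \<Rightarrow> 'a set) \<Rightarrow> (int \<Rightarrow> ('a \<Rightarrow>\<^sub>0 int) \<Rightarrow> ('a \<Rightarrow>\<^sub>0 int)) \<Rightarrow> (int \<Rightarrow> 'b set) \<Rightarrow>
     (int \<Rightarrow> ('a \<Rightarrow>\<^sub>0 int) \<Rightarrow> ('b \<Rightarrow>\<^sub>0 int)) \<Rightarrow>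
     (int \<Rightarrow> ('b \<Rightarrow>\<^sub>0 int) \<Rightarrow> ('a \<Rightarrow>\<^sub>0 int)) \<Rightarrow>
     (int \<Rightarrow> ('a \<Rightarrow>\<^sub>0 int) \<Rightarrow> ('a \<Rightarrow>\<^sub>0 int)) \<Rightarrow> int \<Rightarrow> bool" where
  "AT_model C d H f g \<phi> l \<longleftrightarrow> chain_contraction C d H (\<lambda>q x. 0) f g \<phi> l"

end

theory Submission
  imports Defs
begin

text \<open>
  An invariant factor \<open>p ^ t\<close> yields a class of order \<open>p\<close> in homology, that is, a cycle \<open>x\<close> which
  is not a boundary although \<open>p x = d w\<close>. As the differential of \<open>\<H>\<close> vanishes,
  \<open>p f(x) = f(d w) = 0\<close>, so \<open>f(x) = 0\<close> because \<open>\<H>\<close> is torsion free, and the homotopy formula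
  becomes \<open>\<lambda> x = d(\<phi> x)\<close>. If \<open>p\<close> did not divide \<open>\<lambda>\<close>, Bezout would make \<open>x\<close> itself a boundary.
\<close>

lemma pow_sum_group:
  fixes n :: nat
  shows "x [^]\<^bsub>sum_group I G\<^esub> n = (\<lambda>i\<in>I. x i [^]\<^bsub>G i\<^esub> n)"
  by (induction n) (simp_all add: nat_pow_def fun_eq_iff)

text \<open>Powers depend only on multiplication and unit, so the torsion subgroup and the group of
  cycles share them with the ambient group.\<close>

lemma pow_carrier_update:
  fixes n :: nat
  shows "x [^]\<^bsub>G\<lparr>carrier := A\<rparr>\<^esub> n = x [^]\<^bsub>G\<^esub> n"
  by (simp add: nat_pow_def)

text \<open>Closure under products needs commutativity: if a^m = b^n = 1, then (ab)^(mn) = 1. The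
  result serves to invert the isomorphism in \<open>invariant_factors\<close>.\<close>

lemma group_torsion_subgroup:
  fixes G :: "'a monoid" (structure)
  assumes "comm_group G"
  shows "group (torsion_subgroup G)"
proof -
  interpret comm_group G by fact
  let ?T = "{x \<in> carrier G. \<exists>n::nat. n > 0 \<and> x [^] n = \<one>}"
  have "subgroup ?T G"
  proof (rule subgroupI)
    show "?T \<noteq> {}" by (auto intro!: exI[of _ "\<one>"] exI[of _ "1::nat"])
  next
    fix a assume "a \<in> ?T"
    then obtain n :: nat where a: "a \<in> carrier G" "n > 0" "a [^] n = \<one>" by blast
    then have "inv a [^] n = \<one>" by (simp add: nat_pow_inv)
    with a show "inv a \<in> ?T" by blast
  next
    fix a b assume "a \<in> ?T" "b \<in> ?T"
    then obtain m n :: nat where a: "a \<in> carrier G" "m > 0" "a [^] m = \<one>"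
      and b: "b \<in> carrier G" "n > 0" "b [^] n = \<one>" by blast
    have "a [^] (m * n) = \<one>" using a by (simp flip: nat_pow_pow)
    moreover have "b [^] (m * n) = \<one>"
      using b by (simp add: mult.commute[of m] flip: nat_pow_pow)
    ultimately have "(a \<otimes> b) [^] (m * n) = \<one>" using a b by (simp add: nat_pow_distrib)
    moreover have "m * n > 0" using a b by simp
    ultimately show "a \<otimes> b \<in> ?T" using a b by blast
  qed auto
  then show ?thesis
    unfolding torsion_subgroup_def by (rule subgroup_imp_group)
qed

text \<open>In Z/p^t the element p^(t-1) has order p. Placed in its summand, it is carried into the
  torsion subgroup by the isomorphism, and injectivity keeps it nontrivial.\<close>

lemma invariant_factor_imp_element_of_prime_order:
  fixes G :: "'a monoid" (structure)
  assumes "comm_group G" "prime p" "t \<ge> 1" "invariant_factor G (p ^ t)"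
  obtains x where "x \<in> carrier G" "x \<noteq> \<one>" "x [^] p = \<one>"
proof -
  from assms(4) obtain as where as: "invariant_factors G as" "p ^ t \<in> set as"
    unfolding invariant_factor_def by blast
  then obtain k where k: "k < length as" "as ! k = p ^ t"
    by (auto simp: in_set_conv_nth)
  let ?T = "torsion_subgroup G"
  let ?S = "sum_group {..<length as} (\<lambda>i. integer_mod_group (as ! i))"
  have T: "group ?T" and S: "group ?S" by (auto simp: group_torsion_subgroup[OF assms(1)])
  have "?S \<cong> ?T"
    using as(1) T unfolding invariant_factors_def by (blast intro: group.iso_sym)
  then obtain h where h: "h \<in> iso ?S ?T" unfolding is_iso_def by blast
  interpret h: group_hom ?S ?T h
    using h S T by (simp add: group_hom_def group_hom_axioms_def iso_def)
  \<comment> \<open>The only nonzero entry is at \<open>k\<close>; as \<open>t\<close> is at least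
    1, it is a reduced representative modulo \<open>p ^ t\<close>. Elements of
    \<open>sum_group\<close> are extensional, hence the restricted function.\<close>
  define z where "z = (\<lambda>i\<in>{..<length as}. if i = k then int p ^ (t - 1) else 0)"
  have p: "p > 1" using assms(2) by (rule prime_gt_1_nat)
  have pt: "int p * int p ^ (t - 1) = int p ^ t"
    using assms(3) by (metis power_eq_if not_one_le_zero)
  have z: "z \<in> carrier ?S"
    using k p assms(3) by (auto simp: z_def carrier_sum_group carrier_integer_mod_group)
  have "z [^]\<^bsub>?S\<^esub> p = \<one>\<^bsub>?S\<^esub>"
    using k pt by (subst pow_sum_group) (auto simp: z_def fun_eq_iff)
  then have "h z [^]\<^bsub>?T\<^esub> p = \<one>\<^bsub>?T\<^esub>" using z by (metis h.hom_nat_pow h.hom_one)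
  moreover have "z \<noteq> \<one>\<^bsub>?S\<^esub>"
    using k p by (auto simp: z_def fun_eq_iff)
  then have "h z \<noteq> \<one>\<^bsub>?T\<^esub>"
    using h z h.hom_one h.G.one_closed unfolding iso_def bij_betw_def inj_on_def by force
  moreover have "h z \<in> carrier ?T" using z by simp
  ultimately show thesis
    by (intro that[of "h z"]) (auto simp: torsion_subgroup_def pow_carrier_update)
qed

lemma comm_group_chains: "comm_group (chains C q)"
  by (simp add: chains_def abelian_free_Abelian_group)

text \<open>The definition places the target of \<open>d (q + 1)\<close> in degree
  \<open>q + 1 - 1\<close>; normalising it here lets the locale be interpreted with target
  \<open>chains C q\<close>.\<close>

lemma group_hom_boundary:
  assumes "chain_complex C d"
  shows "group_hom (chains C (q + 1)) (chains C q) (d (q + 1))"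
proof -
  have "d (q + 1) \<in> hom (chains C (q + 1)) (chains C (q + 1 - 1))"
    using assms unfolding chain_complex_def by blast
  then show ?thesis
    by (simp add: group_hom_def group_hom_axioms_def chains_def)
qed

text \<open>Boundaries are cycles because dd = 0, and normality follows from commutativity. This
  makes the quotient in \<open>homology\<close> an abelian group.\<close>

lemma cycles_boundaries:
  assumes "chain_complex C d"
  shows "comm_group ((chains C q)\<lparr>carrier := kernel (chains C q) (chains C (q - 1)) (d q)\<rparr>)"
    and "d (q + 1) ` carrier (chains C (q + 1)) \<lhd>
      (chains C q)\<lparr>carrier := kernel (chains C q) (chains C (q - 1)) (d q)\<rparr>"
proof -
  let ?Z = "kernel (chains C q) (chains C (q - 1)) (d q)"
  let ?B = "d (q + 1) ` carrier (chains C (q + 1))"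
  interpret C: comm_group "chains C q" by (rule comm_group_chains)
  interpret dq: group_hom "chains C q" "chains C (q - 1)" "d q"
    using group_hom_boundary[OF assms, of "q - 1"] by simp
  interpret d': group_hom "chains C (q + 1)" "chains C q" "d (q + 1)"
    by (rule group_hom_boundary[OF assms])
  show comm: "comm_group ((chains C q)\<lparr>carrier := ?Z\<rparr>)"
    by (rule group.group_comm_groupI[OF C.subgroup_imp_group[OF dq.subgroup_kernel]])
      (auto simp: kernel_def C.m_comm)
  have "?B \<subseteq> ?Z"
    using assms unfolding chain_complex_def kernel_def
    by (auto simp: chains_def[of C "q - 1"])
  then have "subgroup ?B ((chains C q)\<lparr>carrier := ?Z\<rparr>)"
    by (rule C.subgroup_incl[OF d'.img_is_subgroup dq.subgroup_kernel])
  then show "?B \<lhd> (chains C q)\<lparr>carrier := ?Z\<rparr>"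
    by (rule comm_group.normal_iff_subgroup[OF comm, THEN iffD2])
qed

lemma comm_group_homology:
  assumes "chain_complex C d"
  shows "comm_group (homology C d q)"
  unfolding homology_def
  using cycles_boundaries[OF assms, of q]
  by (auto intro: comm_group.abelian_FactGroup simp: normal_def)

text \<open>For a representative \<open>x\<close> of the class, triviality of a coset means being a
  boundary, and the n-th power of a chain is its multiple
  \<open>frag_cmul (int n) x\<close>.\<close>

lemma homology_element_of_exponent:
  assumes C: "chain_complex C d"
    and X: "X \<in> carrier (homology C d q)" "X \<noteq> \<one>\<^bsub>homology C d q\<^esub>"
      "X [^]\<^bsub>homology C d q\<^esub> (n::nat) = \<one>\<^bsub>homology C d q\<^esub>"
  obtains x where "x \<in> carrier (chains C q)" "d q x = 0"
    "x \<notin> d (q + 1) ` carrier (chains C (q + 1))"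
    "frag_cmul (int n) x \<in> d (q + 1) ` carrier (chains C (q + 1))"
proof -
  let ?K = "(chains C q)\<lparr>carrier := kernel (chains C q) (chains C (q - 1)) (d q)\<rparr>"
  let ?B = "d (q + 1) ` carrier (chains C (q + 1))"
  interpret B: normal ?B ?K by (rule cycles_boundaries(2)[OF C])
  have hom: "homology C d q = ?K Mod ?B" by (simp add: homology_def)
  \<comment> \<open>As a homomorphism, the projection moves the power of the coset onto the
    representative.\<close>
  interpret Q: group_hom ?K "?K Mod ?B" "\<lambda>a. ?B #>\<^bsub>?K\<^esub> a"
    using B.r_coset_hom_Mod B.factorgroup_is_group B.is_group
    by (simp add: group_hom_def group_hom_axioms_def)
  obtain x where x: "x \<in> carrier ?K" "X = ?B #>\<^bsub>?K\<^esub> x"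
    using X(1) unfolding hom by (auto simp: FactGroup_def RCOSETS_def)
  have one: "?B #>\<^bsub>?K\<^esub> y = \<one>\<^bsub>?K Mod ?B\<^esub> \<longleftrightarrow> y \<in> ?B" if "y \<in> carrier ?K" for y
    using that B.coset_join1 B.coset_join2 B.subgroup_axioms by (auto simp: FactGroup_def)
  have "x \<notin> ?B" using one[OF x(1)] X(2) x(2) unfolding hom by blast
  moreover have "?B #>\<^bsub>?K\<^esub> (x [^]\<^bsub>?K\<^esub> n) = \<one>\<^bsub>?K Mod ?B\<^esub>"
    using X(3) Q.hom_nat_pow[OF x(1), of n] unfolding hom x(2) by metis
  then have "x [^]\<^bsub>?K\<^esub> n \<in> ?B"
    using one[OF B.nat_pow_closed[OF x(1)]] by blast
  moreover have xC: "x \<in> carrier (chains C q)" "d q x = 0"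
    using x(1) by (auto simp: kernel_def chains_def[of C "q - 1"])
  ultimately show thesis
    by (intro that) (auto simp: pow_carrier_update chains_def)
qed

text \<open>Since \<open>n\<close> may be any nonzero integer, \<open>l\<close> annihilates all
  torsion in homology, not only the classes of prime order.\<close>

lemma AT_model_torsion_boundary:
  assumes AT: "AT_model C d H f g \<phi> l"
    and x: "x \<in> carrier (chains C q)" "d q x = 0" and n: "n \<noteq> 0"
    and nx: "frag_cmul n x \<in> d (q + 1) ` carrier (chains C (q + 1))"
  shows "frag_cmul l x \<in> d (q + 1) ` carrier (chains C (q + 1))"
proof -
  have cc: "chain_contraction C d H (\<lambda>q x. 0) f g \<phi> l"
    using AT by (simp add: AT_model_def)
  note cc' = cc[unfolded chain_contraction_def chain_map_def]
  interpret f: group_hom "chains C q" "chains H q" "f q"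
    using cc' by (simp add: group_hom_def group_hom_axioms_def chains_def)
  interpret g: group_hom "chains H q" "chains C q" "g q"
    using cc' by (simp add: group_hom_def group_hom_axioms_def chains_def)
  interpret \<phi>: group_hom "chains C (q - 1)" "chains C q" "\<phi> (q - 1)"
  proof -
    have "\<phi> (q - 1) \<in> hom (chains C (q - 1)) (chains C (q - 1 + 1))" using cc' by blast
    then show "group_hom (chains C (q - 1)) (chains C q) (\<phi> (q - 1))"
      by (simp add: group_hom_def group_hom_axioms_def chains_def)
  qed
  from nx obtain w where w: "w \<in> carrier (chains C (q + 1))" "frag_cmul n x = d (q + 1) w"
    by blast
  \<comment> \<open>With zero differential on the target, the chain map condition says that
    \<open>f\<close> kills boundaries; it is used in degree \<open>q + 1\<close> at
    \<open>w\<close>.\<close>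
  have "\<forall>q. \<forall>x\<in>carrier (chains C q). 0 = f (q - 1) (d q x)"
    using cc' by blast
  from this[rule_format, OF w(1)] have "f q (frag_cmul n x) = 0" using w(2) by simp
  moreover have "f q (frag_cmul n x) = frag_cmul n (f q x)"
    using f.hom_int_pow[OF x(1), of n] x(1) f.hom_closed[OF x(1)] by (simp add: chains_def)
  \<comment> \<open>The free abelian group \<open>chains H q\<close> has no torsion, so
    \<open>n\<close> can be cancelled.\<close>
  ultimately have "f q x = 0" using n by (simp add: frag_cmul_eq_0_iff)
  \<comment> \<open>Both \<open>g q (f q x)\<close> and \<open>\<phi> (q - 1) (d q x)\<close> thus
    vanish in the homotopy formula.\<close>
  moreover have "g q 0 = 0" "\<phi> (q - 1) 0 = 0"
    using g.hom_one \<phi>.hom_one by (simp_all add: chains_def)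
  moreover have "frag_cmul l x - g q (f q x) = \<phi> (q - 1) (d q x) + d (q + 1) (\<phi> q x)"
    using cc' x(1) by blast
  ultimately have "frag_cmul l x = d (q + 1) (\<phi> q x)" using x(2) by simp
  moreover have "\<phi> q x \<in> carrier (chains C (q + 1))"
    using cc' x(1) by (blast intro: hom_in_carrier)
  ultimately show ?thesis by blast
qed

theorem corollary4p7:
  fixes C :: "int \<Rightarrow> 'a set" and d :: "int \<Rightarrow> ('a \<Rightarrow>\<^sub>0 int) \<Rightarrow> ('a \<Rightarrow>\<^sub>0 int)"
    and H :: "int \<Rightarrow> 'b set"
    and f :: "int \<Rightarrow> ('a \<Rightarrow>\<^sub>0 int) \<Rightarrow> ('b \<Rightarrow>\<^sub>0 int)"
    and g :: "int \<Rightarrow> ('b \<Rightarrow>\<^sub>0 int) \<Rightarrow> ('a \<Rightarrow>\<^sub>0 int)"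
    and \<phi> :: "int \<Rightarrow> ('a \<Rightarrow>\<^sub>0 int) \<Rightarrow> ('a \<Rightarrow>\<^sub>0 int)"
    and l q :: int and p t :: nat
  assumes "finite_chain_complex C d"
    and "l \<noteq> 0"
    and "AT_model C d H f g \<phi> l"
    and "prime p" and "t \<ge> 1"
    and "invariant_factor (homology C d q) (p ^ t)"
  shows "int p dvd l"
proof (rule ccontr)
  let ?B = "d (q + 1) ` carrier (chains C (q + 1))"
  assume "\<not> int p dvd l"
  with \<open>prime p\<close> have "coprime (int p) l"
    by (simp add: prime_imp_coprime)
  then obtain a b where ab: "a * int p + b * l = 1"
    by (metis bezout_int coprime_imp_gcd_eq_1)
  have C: "chain_complex C d"
    using assms(1) by (simp add: finite_chain_complex_def)
  obtain X where "X \<in> carrier (homology C d q)" "X \<noteq> \<one>\<^bsub>homology C d q\<^esub>"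
      "X [^]\<^bsub>homology C d q\<^esub> p = \<one>\<^bsub>homology C d q\<^esub>"
    using invariant_factor_imp_element_of_prime_order
      [OF comm_group_homology[OF C] assms(4,5,6)] .
  then obtain x where x: "x \<in> carrier (chains C q)" "d q x = 0" "x \<notin> ?B"
      and px: "frag_cmul (int p) x \<in> ?B"
    by (rule homology_element_of_exponent[OF C])
  have lx: "frag_cmul l x \<in> ?B"
    using AT_model_torsion_boundary[OF assms(3) x(1,2) _ px] prime_gt_0_nat[OF assms(4)] by simp
  interpret d': group_hom "chains C (q + 1)" "chains C q" "d (q + 1)"
    by (rule group_hom_boundary[OF C])
  interpret B: subgroup ?B "chains C q" by (rule d'.img_is_subgroup)
  \<comment> \<open>Integer multiples are integer powers in the chain group, so the subgroup of
    boundaries is closed under them.\<close>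
  have cmul: "frag_cmul c y \<in> ?B" if "y \<in> ?B" for c y
    using d'.H.subgroup_int_pow_closed[OF B.subgroup_axioms that, of c] B.mem_carrier[OF that]
    by (simp add: chains_def)
  have "frag_cmul a (frag_cmul (int p) x) + frag_cmul b (frag_cmul l x) \<in> ?B"
    using B.m_closed[OF cmul[OF px] cmul[OF lx]] by (simp add: chains_def)
  \<comment> \<open>Collecting coefficients of \<open>x\<close> gives
    \<open>a * int p + b * l\<close>, which is 1 by the choice of \<open>a\<close> and
    \<open>b\<close>.\<close>
  also have "frag_cmul a (frag_cmul (int p) x) + frag_cmul b (frag_cmul l x) = x"
    by (simp add: ab flip: frag_cmul_distrib)
  finally show False using x(3) by blast
qed

end
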